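(* Let $\beta>1$ be a root of $x^{d}-mx^{d-1}-\dots-mx-m$ for some positive integers $d,m$. Then $\beta$ has Property ($-$F) if and only if $d\in\{1,3,5\}$.
   Context: The polynomial is $x^d - m\sum_{i=0}^{d-1}x^i$. For a real number $\beta>1$, set $\ell_\beta = \frac{-\beta}{\beta+1}$ and define the $(-\beta)$-transformation $T_{-\beta}: [\ell_\beta,\ell_\beta+1)\to[\ell_\beta,\ell_\beta+1)$ by $T_{-\beta}(x) = -\beta x - \lfloor -\beta x-\ell_\beta\rfloor$. For $x\in[\ell_\beta,\ell_\beta+1)$ let $d_{-\beta}(x)=x_1x_2x_3\cdots$ with $x_i = \lfloor -\beta T_{-\beta}^{i-1}(x)-\ell_\beta\rfloor\in\{0,1,\dots,\lfloor\beta\rfloor\}$, so that $x=\sum_{i\ge1} x_i(-\beta)^{-i}$. For $x\in\mathbb{R}$, let $k\ge 0$ be the minimal integer with $\frac{x}{(-\beta)^k}\in(\ell_\beta,\ell_\beta+1)$ and let $d_{-\beta}(\frac{x}{(-\beta)^k})=x_1x_2x_3\cdots$; the $(-\beta)$-expansion of $x$ is $x_1\cdots x_k\bullet x_{k+1}x_{k+2}\cdots$ if $k\ge1$ and $0\bullet x_1x_2\cdots$ if $k=0$. It is finite if only finitely many digits are nonzero, i.e. if $T_{-\beta}^n(\frac{x}{(-\beta)^k})=0$ for some $n\ge0$. The number $\beta$ has Property ($-$F) if each element of $\mathbb{Z}[\beta^{-1}]$ has a finite $(-\beta)$-expansion. *)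

theory Defs
  imports Complex_Main "HOL-Computational_Algebra.Polynomial"
begin

text \<open>All notions below are meant for a real base \<open>\<beta> > 1\<close>.\<close>

definition neg_left :: "real \<Rightarrow> real"
  where "neg_left \<beta> = - \<beta> / (\<beta> + 1)"

text \<open>The transformation acts on \<open>{neg_left \<beta>..<neg_left \<beta> + 1}\<close>. The formula is total on the
  reals, but it and the digits are only applied to points of this interval.\<close>

definition neg_trans :: "real \<Rightarrow> real \<Rightarrow> real"
  where "neg_trans \<beta> x = - \<beta> * x - of_int \<lfloor>- \<beta> * x - neg_left \<beta>\<rfloor>"

text \<open>Digits are numbered from 1, so only arguments \<open>i \<ge> 1\<close> are meaningful.\<close>

definition neg_digit :: "real \<Rightarrow> real \<Rightarrow> nat \<Rightarrow> int"
  where "neg_digit \<beta> x i = \<lfloor>- \<beta> * (neg_trans \<beta> ^^ (i - 1)) x - neg_left \<beta>\<rfloor>"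

text \<open>The minimum exists for every \<open>x\<close>, because 0 is an interior point of the interval.\<close>

definition neg_shift :: "real \<Rightarrow> real \<Rightarrow> nat"
  where "neg_shift \<beta> x =
    (LEAST k. x / (- \<beta>) ^ k \<in> {neg_left \<beta><..<neg_left \<beta> + 1})"

text \<open>The expansion is the pair of the digits before the point (most significant first) and
  the sequence of digits after the point, whose entry number \<open>j\<close> (counted from 0) belongs to
  the power \<open>(-\<beta>) ^ -(j + 1)\<close>.\<close>

definition neg_expansion :: "real \<Rightarrow> real \<Rightarrow> int list \<times> (nat \<Rightarrow> int)"
  where "neg_expansion \<beta> x =
    (let k = neg_shift \<beta> x;
         a = neg_digit \<beta> (x / (- \<beta>) ^ k)
     in (if k = 0 then [0] else map a [1..<k + 1], \<lambda>j. a (k + 1 + j)))"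

text \<open>The digits before the point form a list, so only those after it can be nonzero
  infinitely often.\<close>

definition finite_neg_expansion :: "real \<Rightarrow> real \<Rightarrow> bool"
  where "finite_neg_expansion \<beta> x \<longleftrightarrow> finite {j. snd (neg_expansion \<beta> x) j \<noteq> 0}"

definition int_adjoin :: "real \<Rightarrow> real set"
  where "int_adjoin a = range (\<lambda>p :: int poly. poly (map_poly of_int p) a)"

definition property_neg_F :: "real \<Rightarrow> bool"
  where "property_neg_F \<beta> \<longleftrightarrow> (\<forall>x \<in> int_adjoin (inverse \<beta>). finite_neg_expansion \<beta> x)"

end

theory Submission
  imports Defs
begin

text \<open>
  Iterating \<open>T = neg_trans \<beta>\<close> drives every element of \<open>\<int>[\<beta>\<^sup>-\<^sup>1]\<close> into \<open>\<int>[\<beta>]\<close>, so Property (-F) means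
  that the \<open>T\<close>-orbit of every element of \<open>\<int>[\<beta>]\<close> in the interval reaches 0.

  For even \<open>d\<close>, grouping \<open>1 = m (\<beta>\<^sup>-\<^sup>1 + \<dots> + \<beta>\<^sup>-\<^sup>d)\<close> in pairs shows that \<open>-1 / (\<beta> + 1)\<close> lies in
  \<open>\<int>[\<beta>\<^sup>-\<^sup>1]\<close>, and it is a fixed point of \<open>T\<close>. For odd \<open>d \<ge> 7\<close>, the number
  \<open>- m (\<beta>\<^sup>-\<^sup>3 + \<beta>\<^sup>-\<^sup>4 + \<beta>\<^sup>-\<^sup>5)\<close> has a periodic orbit that avoids 0.

  For \<open>d \<in> {1, 3, 5}\<close> the argument is Brunotte's. The Horner values \<open>u\<^sub>0 = 1\<close>, \<open>u\<^sub>j\<^sub>+\<^sub>1 = \<beta> u\<^sub>j - m\<close>,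
  \<open>u\<^sub>d = 0\<close> span \<open>\<int>[\<beta>]\<close> over \<open>\<int>\<close>, and in the coordinates \<open>\<Sum> (-1)\<^sup>j u\<^sub>j z\<^sub>j\<close> the map \<open>T\<close> shifts the
  window \<open>(z\<^sub>1, \<dots>, z\<^sub>d\<^sub>-\<^sub>1)\<close> and prepends an integer chosen by rounding. Adding an element of a finite set
  of windows that is closed under rounding either way changes every point of an orbit only by elements
  of that set. So if all orbits from such a set end at 0 and the set generates \<open>\<int>[\<beta>]\<close> modulo \<open>\<int>\<close>,
  then all orbits end at 0.
\<close>

section \<open>Orbits of the transformation\<close>

definition neg_dom :: "real \<Rightarrow> real set"
  where "neg_dom \<beta> = {neg_left \<beta>..<neg_left \<beta> + 1}"

definition neg_reduce :: "real \<Rightarrow> real \<Rightarrow> real"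
  where "neg_reduce \<beta> x = x - of_int \<lfloor>x - neg_left \<beta>\<rfloor>"

definition ends_at_zero :: "real \<Rightarrow> real \<Rightarrow> bool"
  where "ends_at_zero \<beta> x \<longleftrightarrow> (\<exists>n. (neg_trans \<beta> ^^ n) x = 0)"

lemma neg_trans_eq_reduce: "neg_trans \<beta> x = neg_reduce \<beta> (- \<beta> * x)"
  by (simp add: neg_trans_def neg_reduce_def)

lemma neg_reduce_in_dom: "neg_reduce \<beta> x \<in> neg_dom \<beta>"
  unfolding neg_reduce_def neg_dom_def by simp linarith

lemma neg_trans_in_dom: "neg_trans \<beta> x \<in> neg_dom \<beta>"
  by (simp add: neg_trans_eq_reduce neg_reduce_in_dom)

text \<open>The half-open interval has length 1, so it meets each class modulo 1 exactly once.
  Images under \<open>neg_trans\<close> are later identified this way, without evaluating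
  floors.\<close>

lemma neg_reduce_eqI:
  assumes "y \<in> neg_dom \<beta>" "x - y \<in> \<int>"
  shows "neg_reduce \<beta> x = y"
proof -
  obtain k where k: "x = y + of_int k"
    using assms(2) by (metis Ints_cases add.commute diff_add_cancel)
  have "\<lfloor>y - neg_left \<beta>\<rfloor> = 0"
    using assms(1) by (simp add: neg_dom_def floor_eq_iff)
  moreover have "x - neg_left \<beta> = (y - neg_left \<beta>) + of_int k"
    using k by simp
  ultimately have "\<lfloor>x - neg_left \<beta>\<rfloor> = k"
    by (metis add_0 floor_add_int)
  then show ?thesis by (simp add: neg_reduce_def k)
qed

lemma neg_reduce_id: "x \<in> neg_dom \<beta> \<Longrightarrow> neg_reduce \<beta> x = x"
  by (rule neg_reduce_eqI) auto

lemma neg_reduce_diff_Ints: "x - neg_reduce \<beta> x \<in> \<int>"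
  by (simp add: neg_reduce_def)

lemma neg_trans_eqI: "y \<in> neg_dom \<beta> \<Longrightarrow> y + \<beta> * x \<in> \<int> \<Longrightarrow> neg_trans \<beta> x = y"
  unfolding neg_trans_eq_reduce
  by (rule neg_reduce_eqI) (auto simp: minus_diff_commute dest: Ints_minus)

lemma neg_trans_Ints: "neg_trans \<beta> x + \<beta> * x \<in> \<int>"
  by (simp add: neg_trans_def)

lemma neg_left_eq: "\<beta> > 0 \<Longrightarrow> neg_left \<beta> = 1 / (\<beta> + 1) - 1"
  by (simp add: neg_left_def field_simps)

lemma neg_dom_iff: "\<beta> > 0 \<Longrightarrow> x \<in> neg_dom \<beta> \<longleftrightarrow> 1 / (\<beta> + 1) - 1 \<le> x \<and> x < 1 / (\<beta> + 1)"
  by (auto simp: neg_dom_def neg_left_eq)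

lemma zero_in_neg_dom: "\<beta> > 0 \<Longrightarrow> 0 \<in> neg_dom \<beta>"
  by (simp add: neg_dom_iff field_simps)

text \<open>Since \<open>\<beta> > 1\<close>, the right end \<open>1 / (\<beta> + 1)\<close> is the
  one nearer to 0.\<close>

lemma abs_less_in_neg_dom:
  assumes "\<beta> > 1" "\<bar>x\<bar> < 1 / (\<beta> + 1)" shows "x \<in> neg_dom \<beta>"
proof -
  have "1 / (\<beta> + 1) < 1 / 2" using assms(1) by (simp add: field_simps)
  then have "1 / (\<beta> + 1) - 1 \<le> x" "x < 1 / (\<beta> + 1)" using assms(2) by linarith+
  then show ?thesis using assms(1) by (simp add: neg_dom_iff)
qed

lemma neg_trans_zero [simp]: "\<beta> > 0 \<Longrightarrow> neg_trans \<beta> 0 = 0"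
  by (rule neg_trans_eqI) (simp_all add: zero_in_neg_dom)

lemma neg_trans_iter_in_dom: "x \<in> neg_dom \<beta> \<Longrightarrow> (neg_trans \<beta> ^^ n) x \<in> neg_dom \<beta>"
  by (cases n) (auto simp: neg_trans_in_dom)

lemma ends_at_zero_zero: "ends_at_zero \<beta> 0"
  unfolding ends_at_zero_def by (rule exI[of _ 0]) simp

lemma ends_at_zero_step:
  assumes "ends_at_zero \<beta> (neg_trans \<beta> x)" shows "ends_at_zero \<beta> x"
proof -
  obtain n where "(neg_trans \<beta> ^^ n) (neg_trans \<beta> x) = 0"
    using assms by (auto simp: ends_at_zero_def)
  then have "(neg_trans \<beta> ^^ Suc n) x = 0"
    by (simp add: funpow_swap1)
  then show ?thesis unfolding ends_at_zero_def by blast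
qed

lemma ends_at_zero_iter: "ends_at_zero \<beta> ((neg_trans \<beta> ^^ n) x) \<Longrightarrow> ends_at_zero \<beta> x"
  by (induction n) (auto intro: ends_at_zero_step simp: ends_at_zero_step funpow_swap1)

section \<open>Finite expansions and orbits that reach 0\<close>

lemma neg_shift_in_interior:
  assumes "\<beta> > 1"
  shows "x / (- \<beta>) ^ neg_shift \<beta> x \<in> {neg_left \<beta><..<neg_left \<beta> + 1}"
proof -
  have l: "neg_left \<beta> < 0" "neg_left \<beta> + 1 > 0"
    using assms by (auto simp: neg_left_eq field_simps)
  have "(\<lambda>k. x * (inverse (- \<beta>)) ^ k) \<longlonglongrightarrow> x * 0"
    using assms by (intro tendsto_mult tendsto_const LIMSEQ_power_zero) (auto simp: field_simps)
  then have "(\<lambda>k. x / (- \<beta>) ^ k) \<longlonglongrightarrow> 0"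
    by (simp only: divide_inverse power_inverse mult_zero_right)
  then have "\<forall>\<^sub>F k in sequentially. x / (- \<beta>) ^ k \<in> {neg_left \<beta><..<neg_left \<beta> + 1}"
    using l by (intro topological_tendstoD) auto
  then obtain k where "x / (- \<beta>) ^ k \<in> {neg_left \<beta><..<neg_left \<beta> + 1}"
    by (meson eventually_happens' sequentially_bot)
  then show ?thesis
    unfolding neg_shift_def by (rule LeastI)
qed

lemma neg_shift_in_dom:
  "\<beta> > 1 \<Longrightarrow> x / (- \<beta>) ^ neg_shift \<beta> x \<in> neg_dom \<beta>"
  using neg_shift_in_interior[of \<beta> x] by (auto simp: neg_dom_def)

lemma neg_shift_eq_0: "x \<in> {neg_left \<beta><..<neg_left \<beta> + 1} \<Longrightarrow> neg_shift \<beta> x = 0"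
  unfolding neg_shift_def by (rule Least_eq_0) simp

lemma neg_digit_Suc:
  "(neg_trans \<beta> ^^ Suc n) x = - \<beta> * (neg_trans \<beta> ^^ n) x - of_int (neg_digit \<beta> x (Suc n))"
  by (simp add: neg_digit_def neg_trans_def)

text \<open>While the digits vanish, each step multiplies by \<open>- \<beta>\<close>, so a nonzero
  point would leave the bounded interval. Conversely, 0 is fixed and yields only zero
  digits.\<close>

lemma finite_neg_expansion_iff:
  assumes "\<beta> > 1"
  shows "finite_neg_expansion \<beta> x \<longleftrightarrow> ends_at_zero \<beta> (x / (- \<beta>) ^ neg_shift \<beta> x)"
proof -
  define k where "k = neg_shift \<beta> x"
  define y where "y = x / (- \<beta>) ^ k"
  define X where "X = (\<lambda>n. (neg_trans \<beta> ^^ n) y)"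
  have fin: "finite_neg_expansion \<beta> x \<longleftrightarrow> finite {j. neg_digit \<beta> y (Suc (k + j)) \<noteq> 0}"
    by (simp add: finite_neg_expansion_def neg_expansion_def Let_def k_def y_def)
  have step: "X (Suc n) = - \<beta> * X n - of_int (neg_digit \<beta> y (Suc n))" for n
    unfolding X_def by (rule neg_digit_Suc)
  have dom: "X n \<in> neg_dom \<beta>" for n
    unfolding X_def using neg_shift_in_dom[OF assms, of x]
    by (intro neg_trans_iter_in_dom) (simp add: y_def k_def)
  have bound: "\<bar>X n\<bar> < 1" for n
  proof -
    have "0 < 1 / (\<beta> + 1)" "1 / (\<beta> + 1) < 1" using assms by (auto simp: field_simps)
    moreover have "1 / (\<beta> + 1) - 1 \<le> X n" "X n < 1 / (\<beta> + 1)"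
      using dom[of n] assms by (simp_all add: neg_dom_iff)
    ultimately show ?thesis by linarith
  qed
  have "ends_at_zero \<beta> y" if f: "finite {j. neg_digit \<beta> y (Suc (k + j)) \<noteq> 0}"
  proof -
    obtain N where N: "\<And>j. j > N \<Longrightarrow> neg_digit \<beta> y (Suc (k + j)) = 0"
      using finite_nat_bounded[OF f]
      by (auto simp: subset_iff) (meson less_asym linorder_neqE_nat order.strict_trans)
    \<comment> \<open>The \<open>k\<close> digits before the point may be nonzero, and
      \<open>N\<close> controls only \<open>j > N\<close>; hence the offset.\<close>
    define n where "n = k + Suc N"
    have X0: "X (n + i) = (- \<beta>) ^ i * X n" for i
    proof (induction i)
      case (Suc i)
      have "neg_digit \<beta> y (Suc (n + i)) = 0"
        using N[of "Suc N + i"] by (simp add: n_def add_ac)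
      then show ?case using step[of "n + i"] Suc by simp
    qed simp
    have "X n = 0"
    proof (rule ccontr)
      assume nz: "X n \<noteq> 0"
      obtain i where i: "1 / \<bar>X n\<bar> < \<beta> ^ i"
        using real_arch_pow[OF assms] by blast
      have "\<bar>X (n + i)\<bar> = \<beta> ^ i * \<bar>X n\<bar>"
        using assms by (simp add: X0 abs_mult power_abs)
      also have "\<dots> > 1" using i nz by (simp add: field_simps)
      finally show False using bound[of "n + i"] by simp
    qed
    then show ?thesis unfolding ends_at_zero_def X_def by blast
  qed
  moreover have "finite {j. neg_digit \<beta> y (Suc (k + j)) \<noteq> 0}" if e: "ends_at_zero \<beta> y"
  proof -
    obtain n where n: "X n = 0" using e by (auto simp: ends_at_zero_def X_def)
    have X0: "X (n + i) = 0" for i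
      using n assms by (induction i) (auto simp: X_def)
    have "neg_digit \<beta> y (Suc (k + j)) = 0" if "j \<ge> n" for j
    proof -
      have "X (k + j) = 0" "X (Suc (k + j)) = 0"
        using X0[of "k + j - n"] X0[of "Suc (k + j) - n"] that by auto
      then show ?thesis using step[of "k + j"] by simp
    qed
    then have "{j. neg_digit \<beta> y (Suc (k + j)) \<noteq> 0} \<subseteq> {..<n}"
      by (auto simp: not_le[symmetric])
    then show ?thesis by (rule finite_subset) simp
  qed
  ultimately show ?thesis unfolding fin k_def[symmetric] y_def[symmetric] by blast
qed

section \<open>The ring generated by a real number over the integers\<close>

lemma int_adjoin_of_int: "of_int c \<in> int_adjoin a"
  unfolding int_adjoin_def by (rule range_eqI[of _ _ "[:c:]"]) (simp add: map_poly_pCons)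

lemma int_adjoin_mult_gen:
  assumes "x \<in> int_adjoin a" shows "a * x \<in> int_adjoin a"
proof -
  obtain p :: "int poly" where "x = poly (map_poly of_int p) a"
    using assms by (auto simp: int_adjoin_def)
  then show ?thesis
    unfolding int_adjoin_def by (intro range_eqI[of _ _ "pCons 0 p"]) (simp add: map_poly_pCons)
qed

lemma int_adjoin_add:
  assumes "x \<in> int_adjoin a" "y \<in> int_adjoin a" shows "x + y \<in> int_adjoin a"
proof -
  have hom: "map_poly of_int (p + q) = map_poly of_int p + (map_poly of_int q :: real poly)"
    for p q :: "int poly" by (intro poly_eqI) (simp add: coeff_map_poly)
  obtain p q :: "int poly"
    where "x = poly (map_poly of_int p) a" "y = poly (map_poly of_int q) a"
    using assms by (auto simp: int_adjoin_def)
  then have "x + y = poly (map_poly of_int (p + q)) a" by (simp add: hom)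
  then show ?thesis unfolding int_adjoin_def by blast
qed

lemma int_adjoin_mult_int:
  assumes "x \<in> int_adjoin a" shows "of_int c * x \<in> int_adjoin a"
proof -
  have hom: "map_poly of_int (smult c p) = smult (of_int c) (map_poly of_int p :: real poly)"
    for p :: "int poly" by (intro poly_eqI) (simp add: coeff_map_poly)
  obtain p :: "int poly" where "x = poly (map_poly of_int p) a"
    using assms by (auto simp: int_adjoin_def)
  then have "of_int c * x = poly (map_poly of_int (smult c p)) a" by (simp add: hom)
  then show ?thesis unfolding int_adjoin_def by blast
qed

lemma int_adjoin_minus: "x \<in> int_adjoin a \<Longrightarrow> - x \<in> int_adjoin a"
  using int_adjoin_mult_int[of x a "- 1"] by simp

lemma int_adjoin_mult_power: "x \<in> int_adjoin a \<Longrightarrow> a ^ n * x \<in> int_adjoin a"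
  by (induction n) (auto simp: mult.assoc intro: int_adjoin_mult_gen)

lemma int_adjoin_power: "a ^ n \<in> int_adjoin a"
  using int_adjoin_mult_power[of 1 a n] int_adjoin_of_int[of 1 a] by simp

lemma int_adjoin_induct [consumes 1, case_names zero step]:
  assumes "x \<in> int_adjoin a" and "P 0"
    and "\<And>c y. y \<in> int_adjoin a \<Longrightarrow> P y \<Longrightarrow> P (of_int c + a * y)"
  shows "P x"
proof -
  have "P (poly (map_poly of_int p) a)" for p :: "int poly"
  proof (induction p)
    case 0 then show ?case using assms(2) by simp
  next
    case (pCons c p)
    then show ?case using assms(3)[of "poly (map_poly of_int p) a" c]
      by (simp add: map_poly_pCons int_adjoin_def)
  qed
  then show ?thesis using assms(1) by (auto simp: int_adjoin_def)
qed

text \<open>A power of \<open>- \<beta>\<close> clears the negative powers in \<open>x\<close>, and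
  \<open>i\<close> steps of the map differ from multiplication by \<open>(- \<beta>) ^ i\<close>
  only by an element of \<open>int_adjoin \<beta>\<close>.\<close>

lemma neg_trans_iter_in_int_adjoin:
  assumes "\<beta> > 0" "x \<in> int_adjoin (inverse \<beta>)"
  shows "\<exists>n. (neg_trans \<beta> ^^ n) x \<in> int_adjoin \<beta>"
proof -
  have "\<exists>n. (- \<beta>) ^ n * x \<in> int_adjoin \<beta>"
    using assms(2)
  proof (induction rule: int_adjoin_induct)
    case zero
    show ?case
      using int_adjoin_of_int[of 0 \<beta>] by simp
  next
    case (step c y)
    then obtain n where n: "(- \<beta>) ^ n * y \<in> int_adjoin \<beta>" by blast
    have "\<beta> * inverse \<beta> = 1" using assms(1) by simp
    then have "(- \<beta>) ^ Suc n * (of_int c + inverse \<beta> * y)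
        = of_int ((- 1) ^ Suc n * c) * \<beta> ^ Suc n + - ((- \<beta>) ^ n * y)"
      by (simp add: power_minus[of \<beta>] algebra_simps)
    then show ?case
      by (metis n int_adjoin_add int_adjoin_minus int_adjoin_mult_int int_adjoin_power)
  qed
  then obtain n where n: "(- \<beta>) ^ n * x \<in> int_adjoin \<beta>" by blast
  have "(neg_trans \<beta> ^^ i) x + - ((- \<beta>) ^ i * x) \<in> int_adjoin \<beta>" for i
  proof (induction i)
    case 0 show ?case using int_adjoin_of_int[of 0 \<beta>] by simp
  next
    case (Suc i)
    have "(neg_trans \<beta> ^^ Suc i) x + - ((- \<beta>) ^ Suc i * x)
        = - (\<beta> * ((neg_trans \<beta> ^^ i) x + - ((- \<beta>) ^ i * x)))
          + - of_int \<lfloor>- \<beta> * (neg_trans \<beta> ^^ i) x - neg_left \<beta>\<rfloor>"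
      by (simp add: neg_trans_def algebra_simps)
    then show ?case
      using Suc by (metis int_adjoin_add int_adjoin_minus int_adjoin_mult_gen int_adjoin_of_int)
  qed
  from int_adjoin_add[OF this[of n] n] show ?thesis by auto
qed

lemma property_neg_FI:
  assumes "\<beta> > 1" "\<And>x. x \<in> int_adjoin \<beta> \<Longrightarrow> x \<in> neg_dom \<beta> \<Longrightarrow> ends_at_zero \<beta> x"
  shows "property_neg_F \<beta>"
  unfolding property_neg_F_def
proof
  fix x assume x: "x \<in> int_adjoin (inverse \<beta>)"
  define k where "k = neg_shift \<beta> x"
  define y where "y = x / (- \<beta>) ^ k"
  have "y = of_int ((- 1) ^ k) * (inverse \<beta> ^ k * x)"
    using assms(1) by (simp add: y_def power_minus[of \<beta>] field_simps)
  then have "y \<in> int_adjoin (inverse \<beta>)"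
    by (metis x int_adjoin_mult_int int_adjoin_mult_power)
  then obtain n where n: "(neg_trans \<beta> ^^ n) y \<in> int_adjoin \<beta>"
    using neg_trans_iter_in_int_adjoin[of \<beta> y] assms(1) by auto
  have "y \<in> neg_dom \<beta>" unfolding y_def k_def by (rule neg_shift_in_dom[OF assms(1)])
  then have "ends_at_zero \<beta> y"
    by (intro ends_at_zero_iter[of \<beta> n y] assms(2)[OF n] neg_trans_iter_in_dom)
  then show "finite_neg_expansion \<beta> x"
    using assms(1) by (simp add: finite_neg_expansion_iff y_def k_def)
qed

text \<open>An interior point has shift 0, so its expansion is read off its own orbit, which the
  invariant set \<open>P\<close> keeps away from 0.\<close>

lemma not_property_neg_FI:
  assumes "\<beta> > 1" "x \<in> int_adjoin (inverse \<beta>)" "x \<in> {neg_left \<beta><..<neg_left \<beta> + 1}"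
    and "x \<in> P" "0 \<notin> P" "\<And>y. y \<in> P \<Longrightarrow> neg_trans \<beta> y \<in> P"
  shows "\<not> property_neg_F \<beta>"
proof -
  have "(neg_trans \<beta> ^^ n) x \<in> P" for n
    using assms(4,6) by (induction n) auto
  then have "\<not> ends_at_zero \<beta> x"
    using assms(5) by (metis ends_at_zero_def)
  then have "\<not> finite_neg_expansion \<beta> x"
    using assms(1,3) by (simp add: finite_neg_expansion_iff neg_shift_eq_0)
  then show ?thesis
    using assms(2) by (auto simp: property_neg_F_def)
qed

section \<open>Periodic orbits\<close>

text \<open>The equation times \<open>\<beta> - 1\<close>, divided by
  \<open>\<beta> ^ (d + 1)\<close>: the geometric sum disappears, and what follows becomes
  polynomial algebra.\<close>

lemma root_relation:
  fixes \<beta> :: real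
  assumes "\<beta> > 1" "\<beta> ^ d = m * (\<Sum>i<d. \<beta> ^ i)"
  shows "m * inverse \<beta> * (1 - inverse \<beta> ^ d) = 1 - inverse \<beta>"
proof -
  define S where "S = (\<Sum>i<d. \<beta> ^ i)"
  define B where "B = \<beta> ^ d"
  define Q where "Q = inverse \<beta> ^ d"
  define q where "q = inverse \<beta>"
  have "B = m * S" "B - 1 = (\<beta> - 1) * S"
    using assms(2) power_diff_1_eq[of \<beta> d] by (simp_all add: B_def S_def)
  moreover have "B * Q = 1" "\<beta> * q = 1"
    using assms(1) by (simp_all add: B_def Q_def q_def flip: power_mult_distrib)
  ultimately have "m * q * (1 - Q) = 1 - q"
    by algebra
  then show ?thesis by (simp add: Q_def q_def)
qed

lemma not_property_neg_F_even:
  fixes \<beta> :: real and m :: nat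
  assumes "\<beta> > 1" "even d" "\<beta> ^ d = real m * (\<Sum>i<d. \<beta> ^ i)"
  shows "\<not> property_neg_F \<beta>"
proof -
  obtain e where d: "d = 2 * e" using assms(2) by blast
  define q where "q = inverse \<beta>"
  have q: "\<beta> * q = 1" using assms(1) by (simp add: q_def)
  \<comment> \<open>As \<open>q ^ (2 * i + 1) + q ^ (2 * i + 2) = (\<beta> + 1) * q ^ (2 * i +
    2)\<close>, the even powers alone account for the whole sum:
    \<open>m * S * (\<beta> + 1) = 1\<close>.\<close>
  define S where "S = (\<Sum>i<e. q ^ (2 * i + 2))"
  define Q where "Q = q ^ d"
  have "(\<Sum>i<e. q ^ (2 * i + 2)) * (1 - q ^ 2) = q ^ 2 * (1 - q ^ d)"
    unfolding d
  proof (induction e)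
    case (Suc e)
    then show ?case by (simp add: distrib_right) (simp add: algebra_simps power2_eq_square)
  qed simp
  then have sum: "S * (1 - q ^ 2) = q ^ 2 * (1 - Q)" by (simp only: S_def Q_def)
  have rel: "real m * q * (1 - Q) = 1 - q"
    unfolding Q_def q_def using root_relation[OF assms(1,3)] .
  have "1 - q \<noteq> 0" using assms(1) by (simp add: q_def)
  moreover have "(1 - q) * (real m * S * (\<beta> + 1)) = (1 - q) * 1"
    using sum rel q by algebra
  ultimately have "real m * S * (\<beta> + 1) = 1"
    using mult_left_cancel by blast
  then have x: "real m * S = 1 / (\<beta> + 1)"
    using assms(1) by (simp add: field_simps)
  have "(\<Sum>i<k. q ^ (2 * i + 2)) \<in> int_adjoin q" for k
    using int_adjoin_of_int[of 0 q]
    by (induction k) (auto intro: int_adjoin_add int_adjoin_power simp del: power_Suc)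
  from int_adjoin_mult_int[OF this, of "int m" e] have "real m * S \<in> int_adjoin q"
    by (simp add: S_def)
  then have "- (1 / (\<beta> + 1)) \<in> int_adjoin q" unfolding x by (rule int_adjoin_minus)
  moreover have "neg_trans \<beta> (- (1 / (\<beta> + 1))) = - (1 / (\<beta> + 1))"
  proof (rule neg_trans_eqI)
    show "- (1 / (\<beta> + 1)) \<in> neg_dom \<beta>" using assms(1) by (simp add: neg_dom_iff field_simps)
    have "- (1 / (\<beta> + 1)) + \<beta> * - (1 / (\<beta> + 1)) = - 1" using assms(1) by (simp add: field_simps)
    then show "- (1 / (\<beta> + 1)) + \<beta> * - (1 / (\<beta> + 1)) \<in> \<int>" by simp
  qed
  moreover have "- (1 / (\<beta> + 1)) \<in> {neg_left \<beta><..<neg_left \<beta> + 1}"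
    using assms(1) by (auto simp: neg_left_eq field_simps)
  ultimately show ?thesis
    using assms(1)
    by (intro not_property_neg_FI[of \<beta> "- (1 / (\<beta> + 1))" "{- (1 / (\<beta> + 1))}"]) (auto simp: q_def)
qed

text \<open>With \<open>A = m (q + q\<^sup>2 + q\<^sup>3)\<close>, \<open>n = d - 3\<close> and \<open>v = q\<^sup>3 - q\<^sup>n\<^sup>+\<^sup>3 (A + m)\<close>, the orbit repeats
  \<open>A q\<^sup>n\<^sup>-\<^sup>1, - A q\<^sup>n\<^sup>-\<^sup>2, \<dots>, - A q\<^sup>2, A q - 1, v, - \<beta> v, \<beta>\<^sup>2 v - 1\<close>. Everything follows from
  \<open>m q (1 - q\<^sup>d) = 1 - q\<close>.\<close>

lemma not_property_neg_F_odd: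
  fixes \<beta> :: real and m :: nat
  assumes "\<beta> > 1" "m > 0" "odd d" "d \<ge> 7" "\<beta> ^ d = real m * (\<Sum>i<d. \<beta> ^ i)"
  shows "\<not> property_neg_F \<beta>"
proof -
  define q where "q = inverse \<beta>"
  have q: "\<beta> * q = 1" "0 < q" "q < 1" using assms(1) by (simp_all add: q_def field_simps)
  define M where "M = real m"
  have M: "M \<ge> 1" using assms(2) by (simp add: M_def)
  define n where "n = d - 3"
  have n: "d = n + 3" "n \<ge> 4" "even n" using assms(3,4) by (auto simp: n_def)
  define Y where "Y = q ^ n"
  \<comment> \<open>The hypothesis \<open>d \<ge> 7\<close> enters here; this bound leads to
    \<open>Z < q ^ 2\<close>.\<close>
  have Y4: "Y \<le> q ^ 4" unfolding Y_def using q n by (intro power_decreasing) auto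
  have Y: "0 < Y" "q ^ d = Y * q ^ 3"
    using q n by (auto simp: Y_def power_add)
  have "q ^ 4 < 1" using q by (intro power_Suc_less_one[of q 3, simplified]) auto
  then have Y1: "Y < 1" using Y4 by simp
  define A where "A = M * (q + q ^ 2 + q ^ 3)"
  have rel: "M * q * (1 - Y * q ^ 3) = 1 - q"
    using root_relation[OF assms(1,5)] by (simp add: q_def[symmetric] Y(2) M_def)
  have A: "A * (1 - Y * q ^ 3) = 1 - q ^ 3"
    using rel unfolding A_def by algebra
  have qA: "q + q ^ 2 + q ^ 3 \<le> A"
    unfolding A_def using mult_right_mono[OF M, of "q + q ^ 2 + q ^ 3"] q by simp
  have q3: "0 < q ^ 3" "q ^ 3 < q" "Y * q ^ 3 < q ^ 3"
    using q power_strict_decreasing[of 1 3 q] Y Y1 by auto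
  have A1: "A < 1"
  proof (rule ccontr)
    assume "\<not> A < 1"
    then have "1 * (1 - Y * q ^ 3) \<le> A * (1 - Y * q ^ 3)"
      using q3 q by (intro mult_right_mono; linarith)
    then show False using A q3 by simp
  qed
  have Mq: "M * q < 1"
  proof (rule ccontr)
    assume "\<not> M * q < 1"
    then have "1 * (1 - Y * q ^ 3) \<le> M * q * (1 - Y * q ^ 3)"
      using q3 q by (intro mult_right_mono; linarith)
    then show False using rel q3 by simp
  qed
  \<comment> \<open>Equivalently, \<open>\<beta>\<close> exceeds the golden ratio. The bounds on
    \<open>Z\<close> and \<open>t\<close> below rest on this.\<close>
  have qq: "q + q ^ 2 < 1" using qA A1 q3 by linarith
  have A0: "A > 0" using qA q by (intro less_le_trans[OF _ qA] add_pos_pos) auto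
  define Z where "Z = Y * (A + M)"
  have Z0: "Z > 0" using Y A0 M by (simp add: Z_def)
  have "Z \<le> q ^ 4 * (A + M)"
    unfolding Z_def using Y4 A0 M by (intro mult_right_mono) auto
  also have "\<dots> = q ^ 4 * A + q ^ 3 * (M * q)" by algebra
  also have "\<dots> < q ^ 4 * 1 + q ^ 3 * 1"
    using A1 Mq q by (intro add_strict_mono mult_strict_left_mono) auto
  also have "\<dots> = q ^ 2 * (q + q ^ 2)" by algebra
  also have "\<dots> < q ^ 2 * 1" using qq q by (intro mult_strict_left_mono) auto
  finally have Zq: "Z < q ^ 2" by simp
  have q2: "q ^ 2 < q" "0 < q ^ 2" using q power_strict_decreasing[of 1 2 q] by auto
  have Zq': "Z * (1 + q) < q"
  proof -
    have "Z * (1 + q) < q ^ 2 * (1 + q)" using Zq q by (intro mult_strict_right_mono) auto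
    also have "\<dots> = q * (q + q ^ 2)" by algebra
    also have "\<dots> < q * 1" using qq q by (intro mult_strict_left_mono) auto
    finally show ?thesis by simp
  qed
  \<comment> \<open>The right end of the interval; \<open>t * (1 + q) = q\<close> turns comparisons
    with it into polynomial inequalities.\<close>
  define t where "t = 1 / (\<beta> + 1)"
  have "t * (\<beta> + 1) = 1" using assms(1) by (simp add: t_def)
  then have t: "t * (1 + q) = q" using q(1) by algebra
  have t_le: "t \<le> x" if "q \<le> x * (1 + q)" for x
  proof -
    have "t * (1 + q) \<le> x * (1 + q)" using that t by simp
    then show ?thesis using q by simp
  qed
  have q2t: "q ^ 2 < t"
  proof -
    have "q ^ 2 * (1 + q) = q * (q + q ^ 2)" by algebra
    also have "\<dots> < q * 1" using qq q by (intro mult_strict_left_mono) auto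
    finally have "q ^ 2 * (1 + q) < t * (1 + q)" by (simp add: t)
    then show ?thesis using q by simp
  qed
  have dom: "x \<in> neg_dom \<beta>" if "\<bar>x\<bar> < q ^ 2" for x
    using that q2t assms(1) by (intro abs_less_in_neg_dom) (auto simp: t_def)
  \<comment> \<open>The left end is \<open>t - 1\<close>, so the first condition says
    \<open>t \<le> x\<close>.\<close>
  have dom': "x - 1 \<in> neg_dom \<beta>" if "q \<le> x * (1 + q)" "x < 1" for x
  proof -
    have "x - 1 < t" using that(2) q2t q2 by linarith
    then show ?thesis using t_le[OF that(1)] assms(1) by (simp add: neg_dom_iff t_def)
  qed
  define v where "v = q ^ 3 * (1 - Z)"
  have v: "0 < v" "\<beta> * v = q ^ 2 * (1 - Z)" "\<beta> ^ 2 * v = q * (1 - Z)"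
    using q Zq q2 q3 by (simp_all add: v_def) algebra+
  have vq: "\<beta> * v < q ^ 2" "q * (1 - Z) < q"
    using q Z0 mult_strict_left_mono[of "1 - Z" 1 q] mult_strict_left_mono[of "1 - Z" 1 "q ^ 2"]
    by (simp_all add: v(2))
  have v1: "v < \<beta> * v" using assms(1) v(1) by simp
  \<comment> \<open>The point \<open>\<beta> ^ 2 * v - 1\<close> of the cycle appears as
    \<open>q * (1 - Z) - 1\<close>; the orbit is entered at \<open>j = 2\<close>.\<close>
  define P where "P = {- A * (- q) ^ j |j. 2 \<le> j \<and> j < n} \<union> {q * A - 1, v, - \<beta> * v, q * (1 - Z) - 1}"
  have step: "neg_trans \<beta> y \<in> P" if "y \<in> P" for y
  proof -
    have w: "\<bar>- A * (- q) ^ j\<bar> < q ^ 2" if "2 \<le> j" for j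
    proof -
      have "\<bar>- A * (- q) ^ j\<bar> = A * q ^ j" using A0 q by (simp add: abs_mult power_abs)
      also have "\<dots> < 1 * q ^ j" using A1 q by (intro mult_strict_right_mono) auto
      also have "1 * q ^ j \<le> q ^ 2" using q that by (simp add: power_decreasing)
      finally show ?thesis .
    qed
    have T0: "neg_trans \<beta> (q * A - 1) = v"
    proof (rule neg_trans_eqI)
      have "v + \<beta> * (q * A - 1) = - M"
        using A rel q(1) unfolding v_def Z_def by algebra
      then show "v + \<beta> * (q * A - 1) \<in> \<int>" by (simp add: M_def)
    qed (use v v1 vq in \<open>auto intro!: dom\<close>)
    have T1: "neg_trans \<beta> v = - \<beta> * v"
      using v(1) vq(1) assms(1) by (intro neg_trans_eqI dom) (auto simp: abs_mult)
    have T2: "neg_trans \<beta> (- \<beta> * v) = q * (1 - Z) - 1"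
    proof (rule neg_trans_eqI)
      have "q * (1 - Z) - 1 + \<beta> * (- \<beta> * v) = - 1" using v(3) by algebra
      then show "q * (1 - Z) - 1 + \<beta> * (- \<beta> * v) \<in> \<int>" by (metis Ints_0 Ints_1 Ints_minus)
      have "q * (1 + q - Z * (1 + q)) \<ge> q * 1"
        using Zq' q by (intro mult_left_mono) auto
      then show "q * (1 - Z) - 1 \<in> neg_dom \<beta>"
        using vq q by (intro dom') (auto simp: algebra_simps)
    qed
    have T3: "neg_trans \<beta> (q * (1 - Z) - 1) = - A * (- q) ^ (n - 1)"
    proof (rule neg_trans_eqI)
      show "- A * (- q) ^ (n - 1) \<in> neg_dom \<beta>" using n by (intro dom w) auto
      define y where "y = q ^ (n - 1)"
      have "Y = q * y" using n by (simp add: Y_def y_def flip: power_Suc)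
      moreover have "A * (\<beta> - 1) = M * (1 - q ^ 3)"
        using q(1) unfolding A_def by algebra
      moreover have "M * (1 - Y * q ^ 3) = \<beta> - 1"
        using rel q(1) by algebra
      ultimately have "A * y + \<beta> * (q * (1 - Z) - 1) = - M"
        using q(1) unfolding Z_def by algebra
      \<comment> \<open>The cycle closes with the right sign because \<open>n\<close> is even, that
        is, because \<open>d\<close> is odd.\<close>
      moreover have "- A * (- q) ^ (n - 1) = A * y"
        using n by (simp add: y_def power_minus_odd)
      ultimately have "- A * (- q) ^ (n - 1) + \<beta> * (q * (1 - Z) - 1) = - M"
        by simp
      then show "- A * (- q) ^ (n - 1) + \<beta> * (q * (1 - Z) - 1) \<in> \<int>" by (simp add: M_def)
    qed
    have T4: "neg_trans \<beta> (- A * (- q) ^ 2) = q * A - 1"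
    proof (rule neg_trans_eqI)
      have "q * A - 1 + \<beta> * (- A * (- q) ^ 2) = - 1" using q(1) by algebra
      then show "q * A - 1 + \<beta> * (- A * (- q) ^ 2) \<in> \<int>" by (metis Ints_0 Ints_1 Ints_minus)
      have "A \<ge> 1 - q ^ 3"
      proof -
        have "A * (Y * q ^ 3) \<ge> 0" using A0 Y q by simp
        then show ?thesis using A by (simp add: algebra_simps)
      qed
      then have "(1 - q ^ 3) * (1 + q) \<le> A * (1 + q)" using q by (intro mult_right_mono) auto
      moreover have "(1 - q ^ 3) * (1 + q) = 1 + q * (1 - q * (q + q ^ 2))" by algebra
      moreover have "q * (q + q ^ 2) \<le> 1"
        using mult_mono[of q 1 "q + q ^ 2" 1] q qq by simp
      then have "0 \<le> q * (1 - q * (q + q ^ 2))" using q by (intro mult_nonneg_nonneg) auto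
      ultimately have "q * 1 \<le> q * (A * (1 + q))" using q by (intro mult_left_mono) linarith+
      moreover have "q * A < 1" using mult_strict_mono[of q 1 A 1] q A1 A0 by simp
      ultimately show "q * A - 1 \<in> neg_dom \<beta>" by (intro dom') (auto simp: mult.assoc)
    qed
    have T5: "neg_trans \<beta> (- A * (- q) ^ Suc j) = - A * (- q) ^ j" if "2 \<le> j" for j
    proof (rule neg_trans_eqI)
      have "- A * (- q) ^ j + \<beta> * (- A * (- q) ^ Suc j) = 0"
        using q(1) by (simp add: algebra_simps)
      then show "- A * (- q) ^ j + \<beta> * (- A * (- q) ^ Suc j) \<in> \<int>" by (metis Ints_0 Ints_1 Ints_minus)
    qed (intro dom w that)
    from \<open>y \<in> P\<close> consider j where "y = - A * (- q) ^ j" "2 \<le> j" "j < n"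
      | "y = q * A - 1" | "y = v" | "y = - \<beta> * v" | "y = q * (1 - Z) - 1"
      unfolding P_def by blast
    then show ?thesis
    proof cases
      case 1
      show ?thesis
      proof (cases "j = 2")
        case True
        then show ?thesis using 1 T4 by (simp add: P_def)
      next
        case False
        with 1 obtain i where i: "j = Suc i" "2 \<le> i" by (cases j) auto
        then have "neg_trans \<beta> y = - A * (- q) ^ i" using 1 T5 by simp
        then show ?thesis using i 1 unfolding P_def by fastforce
      qed
    next
      case 5
      then have "neg_trans \<beta> y = - A * (- q) ^ (n - 1)" using T3 by simp
      moreover have "2 \<le> n - 1" "n - 1 < n" using n by auto
      ultimately show ?thesis unfolding P_def by blast
    qed (use T0 T1 T2 in \<open>auto simp: P_def\<close>)
  qed
  have x: "\<bar>- A * (- q) ^ 2\<bar> < t"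
  proof -
    have "A * q ^ 2 < 1 * q ^ 2" using A1 q by (intro mult_strict_right_mono) auto
    then show ?thesis using q2t A0 by (simp add: abs_mult)
  qed
  show ?thesis
  proof (rule not_property_neg_FI[OF assms(1), of "- A * (- q) ^ 2" P])
    have "A = of_int (int m) * (q ^ 1 + q ^ 2 + q ^ 3)" by (simp add: A_def M_def)
    then have "A \<in> int_adjoin q"
      by (metis int_adjoin_add int_adjoin_mult_int int_adjoin_power)
    then have "- (q ^ 2 * A) \<in> int_adjoin q"
      by (intro int_adjoin_minus int_adjoin_mult_power)
    then show "- A * (- q) ^ 2 \<in> int_adjoin (inverse \<beta>)"
      by (simp add: mult.commute q_def)
    have "t < 1 / 2" using assms(1) by (simp add: t_def field_simps)
    then have "t - 1 < - A * (- q) ^ 2" "- A * (- q) ^ 2 < t" using x by linarith+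
    then show "- A * (- q) ^ 2 \<in> {neg_left \<beta><..<neg_left \<beta> + 1}"
      using assms(1) by (simp add: neg_left_eq t_def)
    show "- A * (- q) ^ 2 \<in> P" 
    proof -
      have "(2 :: nat) \<le> 2" "2 < n" using n by auto
      then show ?thesis unfolding P_def by blast
    qed
    have "q * A < 1" using mult_strict_mono[of q 1 A 1] q A1 A0 by simp
    moreover have "q * (1 - Z) < 1" using vq q by linarith
    ultimately show "0 \<notin> P" unfolding P_def using A0 q(2) v(1) assms(1) by auto
  qed (rule step)
qed

section \<open>Witness sets\<close>

text \<open>The difference of two points of the interval has absolute value below 1, so along both orbits the
  difference stays in \<open>V\<close>, and once the orbit of \<open>x\<close> is at 0, that of \<open>x + v\<close> is in \<open>V\<close>.\<close>

lemma ends_at_zero_add: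
  assumes "\<beta> > 1" and "ends_at_zero \<beta> x"
    and V: "\<And>v w. v \<in> V \<Longrightarrow> \<bar>w\<bar> < 1 \<Longrightarrow> w + \<beta> * v \<in> \<int> \<Longrightarrow> w \<in> V"
    and fin: "\<And>v. v \<in> V \<Longrightarrow> v \<in> neg_dom \<beta> \<Longrightarrow> ends_at_zero \<beta> v"
    and "v \<in> V" "x \<in> neg_dom \<beta>" "x + v \<in> neg_dom \<beta>"
  shows "ends_at_zero \<beta> (x + v)"
proof -
  obtain n where "(neg_trans \<beta> ^^ n) x = 0"
    using assms(2) by (auto simp: ends_at_zero_def)
  then show ?thesis using assms(5-7)
  proof (induction n arbitrary: x v)
    case 0
    then show ?case using fin by simp
  next
    case (Suc n)
    define w where "w = neg_trans \<beta> (x + v) - neg_trans \<beta> x"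
    have "neg_trans \<beta> (x + v) \<in> neg_dom \<beta>" "neg_trans \<beta> x \<in> neg_dom \<beta>"
      by (rule neg_trans_in_dom)+
    then have w1: "\<bar>w\<bar> < 1" by (auto simp: w_def neg_dom_def)
    have "w + \<beta> * v = (neg_trans \<beta> (x + v) + \<beta> * (x + v)) - (neg_trans \<beta> x + \<beta> * x)"
      by (simp add: w_def algebra_simps)
    then have "w + \<beta> * v \<in> \<int>" by (metis Ints_diff neg_trans_Ints)
    with w1 Suc.prems have wV: "w \<in> V" using V by blast
    have "(neg_trans \<beta> ^^ n) (neg_trans \<beta> x) = 0"
      using Suc.prems by (simp add: funpow_swap1)
    from Suc.IH[OF this wV neg_trans_in_dom] have "ends_at_zero \<beta> (neg_trans \<beta> (x + v))"
      by (simp add: w_def neg_trans_in_dom)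
    then show ?case by (rule ends_at_zero_step)
  qed
qed

section \<open>Horner coordinates and windows\<close>

primrec horner :: "real \<Rightarrow> nat \<Rightarrow> nat \<Rightarrow> real"
  where "horner \<beta> m 0 = 1"
  | "horner \<beta> m (Suc j) = \<beta> * horner \<beta> m j - real m"

text \<open>\<open>window_val \<beta> m 0 (z # zs)\<close> is the number with coordinates \<open>z # zs\<close>. The entry \<open>z\<close> is determined
  by the window \<open>zs\<close>, whose value modulo 1 is \<open>window_val \<beta> m 1 zs\<close>.\<close>

primrec window_val :: "real \<Rightarrow> nat \<Rightarrow> nat \<Rightarrow> int list \<Rightarrow> real"
  where "window_val \<beta> m j [] = 0"
  | "window_val \<beta> m j (z # zs) = (- 1) ^ j * horner \<beta> m j * of_int z + window_val \<beta> m (Suc j) zs"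

text \<open>Makes \<open>horner \<beta> m d = 0\<close> a restatement of the equation for
  \<open>\<beta>\<close>.\<close>

lemma horner_eq: "horner \<beta> m j = \<beta> ^ j - real m * (\<Sum>i<j. \<beta> ^ i)"
proof (induction j)
  case (Suc j)
  have "(\<Sum>i<Suc j. \<beta> ^ i) = 1 + \<beta> * (\<Sum>i<j. \<beta> ^ i)"
    by (simp add: sum.lessThan_Suc_shift sum_distrib_left del: sum.lessThan_Suc)
  then show ?case by (simp only: horner.simps Suc power_Suc) (simp add: algebra_simps)
qed simp

lemma window_val_append:
  "window_val \<beta> m j (xs @ [y]) =
    window_val \<beta> m j xs + (- 1) ^ (j + length xs) * horner \<beta> m (j + length xs) * of_int y"
  by (induction xs arbitrary: j) auto

text \<open>The last entry has weight 0, so windows keep a fixed length: prepending an entry pushes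
  the oldest one out.\<close>

lemma window_val_butlast:
  assumes "horner \<beta> m (j + length zs) = 0"
  shows "window_val \<beta> m j (butlast (z # zs)) = window_val \<beta> m j (z # zs)"
proof -
  obtain xs y where "z # zs = xs @ [y]" by (metis list.distinct(1) rev_exhaust)
  moreover from this have "length xs = length zs"
    by (metis length_append_singleton length_Cons nat.inject)
  ultimately show ?thesis
    using assms by (metis add.right_neutral butlast_snoc mult_zero_left mult_zero_right window_val_append)
qed

lemma window_val_unit:
  "j < n \<Longrightarrow> window_val \<beta> m i ((replicate n 0)[j := c]) = (- 1) ^ (i + j) * horner \<beta> m (i + j) * of_int c"
proof (induction n arbitrary: i j)
  case (Suc n)
  have zero: "window_val \<beta> m k (replicate n 0) = 0" for k
    by (induction n arbitrary: k) auto
  show ?case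
    using Suc.IH[of "j - 1" "Suc i"] Suc.prems by (cases j) (auto simp: zero)
qed simp

text \<open>Multiplying a Horner value by \<open>\<beta>\<close> gives the next one plus
  \<open>m\<close>, and the alternating signs cancel the Horner values, so an entry \<open>z\<close>
  leaves only an integer multiple of \<open>m\<close>. Moving a window one place is thus
  multiplication by \<open>- \<beta>\<close> modulo 1.\<close>

lemma window_val_shift: "window_val \<beta> m (Suc j) zs + \<beta> * window_val \<beta> m j zs \<in> \<int>"
proof (induction zs arbitrary: j)
  case (Cons z zs)
  have "window_val \<beta> m (Suc j) (z # zs) + \<beta> * window_val \<beta> m j (z # zs)
    = of_int ((- 1) ^ j * int m * z) + (window_val \<beta> m (Suc (Suc j)) zs + \<beta> * window_val \<beta> m (Suc j) zs)"
    by (simp add: algebra_simps)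
  then show ?case using Cons by (metis Ints_add Ints_of_int)
qed simp

text \<open>Multiplication by \<open>\<beta>\<close> shifts the coefficients; the top Horner value
  becomes 0, and the resulting multiples of \<open>m\<close> are absorbed by
  \<open>horner \<beta> m 0 = 1\<close>.\<close>

lemma int_adjoin_horner:
  assumes "horner \<beta> m (Suc D) = 0" "x \<in> int_adjoin \<beta>"
  shows "\<exists>c :: nat \<Rightarrow> int. x = (\<Sum>j<Suc D. of_int (c j) * horner \<beta> m j)"
  using assms(2)
proof (induction rule: int_adjoin_induct)
  case zero
  show ?case by (rule exI[of _ "\<lambda>_. 0"]) simp
next
  case (step c0 y)
  then obtain c where c: "y = (\<Sum>j<Suc D. of_int (c j) * horner \<beta> m j)" by blast
  define c' where "c' = (\<lambda>j. case j of 0 \<Rightarrow> c0 + int m * (\<Sum>j<Suc D. c j) | Suc i \<Rightarrow> c i)"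
  have "\<beta> * y = (\<Sum>j<Suc D. real m * of_int (c j) + of_int (c j) * horner \<beta> m (Suc j))"
    unfolding c sum_distrib_left by (intro sum.cong) (auto simp: algebra_simps)
  also have "\<dots> = real m * of_int (\<Sum>j<Suc D. c j) + (\<Sum>j<D. of_int (c j) * horner \<beta> m (Suc j))"
    using assms(1) by (simp add: sum.distrib sum_distrib_left algebra_simps del: horner.simps)
  finally have "of_int c0 + \<beta> * y = (\<Sum>j<Suc D. of_int (c' j) * horner \<beta> m j)"
    by (simp add: sum.lessThan_Suc_shift[of _ D] c'_def del: sum.lessThan_Suc horner.simps(2))
  then show ?case by blast
qed

text \<open>The windows in \<open>W\<close> represent, modulo 1, differences of two points of the
  interval. Such differences fill the range from -1 to 1, so \<open>closed\<close> must admit every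
  \<open>z\<close> leading there, not only the one chosen by \<open>neg_trans\<close>.\<close>

lemma property_neg_F_witness:
  fixes W :: "int list set"
  assumes "\<beta> > 1" "horner \<beta> m (Suc D) = 0"
    and len: "\<And>zs. zs \<in> W \<Longrightarrow> length zs = D"
    and closed: "\<And>z zs. zs \<in> W \<Longrightarrow> \<bar>of_int z + window_val \<beta> m 1 zs\<bar> < 1 \<Longrightarrow> butlast (z # zs) \<in> W"
    and fin: "\<And>zs. zs \<in> W \<Longrightarrow> ends_at_zero \<beta> (neg_reduce \<beta> (window_val \<beta> m 1 zs))"
    and unit: "\<And>j c. j < D \<Longrightarrow> c \<in> {1, - 1} \<Longrightarrow> (replicate D 0)[j := c] \<in> W"
  shows "property_neg_F \<beta>"
proof -
  define V where "V = {v. \<bar>v\<bar> < 1 \<and> (\<exists>zs\<in>W. v - window_val \<beta> m 1 zs \<in> \<int>)}"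
  have V_closed: "w \<in> V" if v: "v \<in> V" and w: "\<bar>w\<bar> < 1" "w + \<beta> * v \<in> \<int>" for v w
  proof -
    obtain zs where zs: "zs \<in> W" "v - window_val \<beta> m 1 zs \<in> \<int>" "\<bar>v\<bar> < 1"
      using v unfolding V_def by blast
    then obtain z where z: "v = of_int z + window_val \<beta> m 1 zs"
      by (metis Ints_cases diff_add_cancel)
    have "butlast (z # zs) \<in> W" using closed[OF zs(1)] zs(3) z by simp
    moreover have "w - window_val \<beta> m 1 (butlast (z # zs)) \<in> \<int>"
    proof -
      have "window_val \<beta> m 1 (butlast (z # zs)) = window_val \<beta> m 1 (z # zs)"
        using len[OF zs(1)] assms(2) by (intro window_val_butlast) (simp del: horner.simps)
      moreover have "window_val \<beta> m 1 (z # zs) + \<beta> * v \<in> \<int>"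
        using window_val_shift[of \<beta> m 0 "z # zs"] z by simp
      moreover have "w - window_val \<beta> m 1 (z # zs) = (w + \<beta> * v) - (window_val \<beta> m 1 (z # zs) + \<beta> * v)"
        by simp
      ultimately show ?thesis using w(2) by (metis Ints_diff)
    qed
    ultimately show ?thesis using w(1) unfolding V_def by blast
  qed
  have V_fin: "ends_at_zero \<beta> v" if v: "v \<in> V" "v \<in> neg_dom \<beta>" for v
  proof -
    obtain zs where zs: "zs \<in> W" "v - window_val \<beta> m 1 zs \<in> \<int>"
      using v(1) unfolding V_def by blast
    from zs(2) have "window_val \<beta> m 1 zs - v \<in> \<int>" by (metis Ints_minus minus_diff_eq)
    then have "neg_reduce \<beta> (window_val \<beta> m 1 zs) = v" by (rule neg_reduce_eqI[OF v(2)])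
    then show ?thesis using fin[OF zs(1)] by simp
  qed
  \<comment> \<open>It remains to reach all of \<open>int_adjoin \<beta>\<close> from 0 inside
    \<open>Q\<close> by adding integers and Horner values of either sign.\<close>
  define Q where "Q = {x. ends_at_zero \<beta> (neg_reduce \<beta> x)}"
  have Q_int: "x + of_int k \<in> Q" if "x \<in> Q" for x k
  proof -
    have "x + of_int k - neg_reduce \<beta> x = (x - neg_reduce \<beta> x) + of_int k" by simp
    then have "x + of_int k - neg_reduce \<beta> x \<in> \<int>"
      by (metis Ints_add Ints_of_int neg_reduce_diff_Ints)
    then have "neg_reduce \<beta> (x + of_int k) = neg_reduce \<beta> x"
      by (rule neg_reduce_eqI[OF neg_reduce_in_dom])
    then show ?thesis using that by (simp add: Q_def)
  qed
  have Q_window: "x + window_val \<beta> m 1 zs \<in> Q" if "x \<in> Q" "zs \<in> W" for x zs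
  proof -
    define y where "y = neg_reduce \<beta> (x + window_val \<beta> m 1 zs)"
    define x' where "x' = neg_reduce \<beta> x"
    have dom: "y \<in> neg_dom \<beta>" "x' \<in> neg_dom \<beta>"
      by (simp_all add: y_def x'_def neg_reduce_in_dom)
    then have "\<bar>y - x'\<bar> < 1" by (auto simp: neg_dom_def)
    moreover have "y - x' - window_val \<beta> m 1 zs
        = (x - x') - (x + window_val \<beta> m 1 zs - y)" by simp
    then have "y - x' - window_val \<beta> m 1 zs \<in> \<int>"
      unfolding x'_def y_def by (metis Ints_diff neg_reduce_diff_Ints)
    ultimately have "y - x' \<in> V" using that(2) unfolding V_def by blast
    moreover have "ends_at_zero \<beta> x'" using that(1) by (simp add: Q_def x'_def)
    ultimately have "ends_at_zero \<beta> (x' + (y - x'))"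
      using dom V_closed V_fin by (intro ends_at_zero_add[OF assms(1), where V = V]) auto
    then show ?thesis by (simp add: Q_def y_def)
  qed
  have Q_horner: "x + of_int c * horner \<beta> m j \<in> Q" if "x \<in> Q" "j < Suc D" for x c j
  proof (cases j)
    case 0
    then show ?thesis using Q_int[OF that(1)] by simp
  next
    case (Suc i)
    then have i: "i < D" using that(2) by simp
    have "\<exists>zs\<in>W. window_val \<beta> m 1 zs = of_int s * horner \<beta> m j" if "s \<in> {1, - 1}" for s
    proof
      \<comment> \<open>Compensates the alternating sign in \<open>window_val\<close>; list position
        \<open>i\<close> carries the weight of index \<open>j = Suc i\<close>.\<close>
      define c where "c = (- 1) ^ j * s"
      have "c \<in> {1, - 1}" using that by (cases "even j") (auto simp: c_def)
      then show "(replicate D 0)[i := c] \<in> W" by (rule unit[OF i])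
      show "window_val \<beta> m 1 ((replicate D 0)[i := c]) = of_int s * horner \<beta> m j"
        using window_val_unit[OF i, of \<beta> m 1 c] Suc
        by (cases "even j") (auto simp: c_def mult.commute simp del: horner.simps)
    qed
    from this[of 1] this[of "- 1"] obtain zs zs' where zs:
      "zs \<in> W" "window_val \<beta> m 1 zs = horner \<beta> m j"
      "zs' \<in> W" "window_val \<beta> m 1 zs' = - horner \<beta> m j"
      by auto
    show ?thesis
    proof (induction c rule: int_induct[of _ 0])
      case base show ?case using that(1) by simp
    next
      case (step1 c)
      then show ?case using Q_window[OF step1(2) zs(1)] zs(2) by (simp add: algebra_simps)
    next
      case (step2 c)
      then show ?case using Q_window[OF step2(2) zs(3)] zs(4) by (simp add: algebra_simps)
    qed
  qed
  have "ends_at_zero \<beta> x" if x: "x \<in> int_adjoin \<beta>" "x \<in> neg_dom \<beta>" for x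
  proof -
    obtain c :: "nat \<Rightarrow> int" where c: "x = (\<Sum>j<Suc D. of_int (c j) * horner \<beta> m j)"
      using int_adjoin_horner[OF assms(2) x(1)] by blast
    have "(\<Sum>j<n. of_int (c j) * horner \<beta> m j) \<in> Q" if "n \<le> Suc D" for n
      using that
    proof (induction n)
      case 0
      have "neg_reduce \<beta> 0 = 0" using assms(1) by (intro neg_reduce_id zero_in_neg_dom) simp
      then show ?case by (simp add: Q_def ends_at_zero_zero)
    qed (simp add: Q_horner)
    from this[of "Suc D"] have "x \<in> Q" by (simp add: c)
    then show ?thesis using neg_reduce_id[OF x(2)] by (simp add: Q_def)
  qed
  then show ?thesis by (rule property_neg_FI[OF assms(1)])
qed

text \<open>One backward step along an orbit: \<open>z\<close> is the integer that brings the value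
  into the interval, and the successor window is already known to end at 0.\<close>

lemma ends_at_zero_window_step:
  assumes "\<beta> > 1" "horner \<beta> m (Suc (length zs)) = 0"
    and "of_int z + window_val \<beta> m 1 zs \<in> neg_dom \<beta>"
    and "ends_at_zero \<beta> (neg_reduce \<beta> (window_val \<beta> m 1 (butlast (z # zs))))"
  shows "ends_at_zero \<beta> (neg_reduce \<beta> (window_val \<beta> m 1 zs))"
proof -
  define y where "y = of_int z + window_val \<beta> m 1 zs"
  define w where "w = window_val \<beta> m 1 (z # zs)"
  have w: "window_val \<beta> m 1 (butlast (z # zs)) = w"
    using assms(2) unfolding w_def by (intro window_val_butlast) (simp del: horner.simps)
  have "w + \<beta> * y \<in> \<int>" using window_val_shift[of \<beta> m 0 "z # zs"] by (simp add: w_def y_def)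
  moreover have "neg_reduce \<beta> w + \<beta> * y = (w + \<beta> * y) - (w - neg_reduce \<beta> w)" by simp
  ultimately have "neg_reduce \<beta> w + \<beta> * y \<in> \<int>"
    by (metis Ints_diff neg_reduce_diff_Ints)
  then have "neg_trans \<beta> y = neg_reduce \<beta> w" by (intro neg_trans_eqI neg_reduce_in_dom)
  then have "ends_at_zero \<beta> y" using assms(4) w by (simp add: ends_at_zero_step)
  moreover have "neg_reduce \<beta> (window_val \<beta> m 1 zs) = y"
    using assms(3) by (intro neg_reduce_eqI) (auto simp: y_def)
  ultimately show ?thesis by simp
qed

section \<open>Explicit witness sets for \<open>d = 3\<close>, \<open>d = 5\<close> and
  \<open>d = 1\<close>\<close>

lemma int_near_cases:
  fixes z :: int and x :: real
  assumes "\<bar>of_int z + x\<bar> < 1"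
  shows "0 < x \<Longrightarrow> x < 1 \<Longrightarrow> z = - 1 \<or> z = 0"
    and "- 1 < x \<Longrightarrow> x < 0 \<Longrightarrow> z = 0 \<or> z = 1"
    and "x = 0 \<Longrightarrow> z = 0"
  using assms by linarith+

text \<open>The set \<open>W\<close> below is the closure of the unit windows under prepending both integers \<open>z\<close> with
  \<open>\<bar>z + window_val \<beta> m 1 zs\<bar> < 1\<close>; it does not depend on \<open>m\<close>. \<open>P\<close> and \<open>N\<close> collect its windows of
  positive and of negative value. Membership facts are linear in \<open>e\<^sub>i = m / \<beta> ^ i\<close>, with
  \<open>t = 1 / (\<beta> + 1)\<close> located by \<open>t = e2 + t * e3\<close> (for \<open>d = 5\<close>: \<open>t = e2 + e4 + t * e5\<close>),
  which follows from \<open>\<Sum>i. e\<^sub>i = 1\<close> and \<open>t * (e\<^sub>i + e\<^sub>i\<^sub>+\<^sub>1) = e\<^sub>i\<^sub>+\<^sub>1\<close>.\<close>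

lemma property_neg_F_3:
  assumes "\<beta> > 1" "m > 0" "horner \<beta> m 3 = 0"
  shows "property_neg_F \<beta>"
proof -
  define q where "q = inverse \<beta>"
  have q: "\<beta> * q = 1" "0 < q" "q < 1" using assms(1) by (simp_all add: q_def field_simps)
  have h0: "horner \<beta> m (Suc (Suc (Suc 0))) = 0"
    using assms(3) by (simp add: numeral_eq_Suc del: horner.simps)
  define e1 e2 e3 where "e1 = m * q" and "e2 = e1 * q" and "e3 = e2 * q"
  \<comment> \<open>Starting from \<open>1 = e1 + e2 + e3\<close>, multiplication by
    \<open>\<beta>\<close> lowers each index by one, and subtracting \<open>m\<close> removes
    \<open>\<beta> * e1\<close>.\<close>
  have h: "horner \<beta> m (Suc 0) = e1 + e2" "horner \<beta> m (Suc (Suc 0)) = e1"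
    and sum: "e1 + e2 + e3 = 1"
    using h0 q(1) unfolding e1_def e2_def e3_def horner.simps by algebra+
  define t where "t = 1 / (\<beta> + 1)"
  have t: "0 < t" "t < 1 / 2" "t < q" using assms(1) by (simp_all add: t_def q_def field_simps)
  have "t * (\<beta> + 1) = 1" using assms(1) by (simp add: t_def)
  then have t_eq: "t = e2 + t * e3"
    using sum q(1) unfolding e1_def e2_def e3_def by algebra
  have dec: "0 < e3" "e3 < e2" "e2 < e1"
    using q assms(2) by (simp_all add: e1_def e2_def e3_def)
  \<comment> \<open>From \<open>m \<ge> 1\<close> follows \<open>q + q * q < 1\<close>, which gives
    \<open>gap\<close>.\<close>
  have "1 \<le> real m" using assms(2) by simp
  from mult_right_mono[OF this, of q] have "q \<le> e1" using q(2) by (simp add: e1_def)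
  moreover have "q * q \<le> e2" using \<open>q \<le> e1\<close> q by (simp add: e2_def)
  ultimately have "q + q * q < 1" using sum dec by linarith
  then have "e * q + e * q * q < e" if "0 < e" for e
    using mult_strict_left_mono[OF _ that, of "q + q * q" 1] by (simp add: algebra_simps)
  from this[of e1] have gap: "e2 + e3 < e1"
    using dec by (simp_all only: e2_def e3_def)
  note \<open>q \<le> e1\<close>
  \<comment> \<open>Bounding the only nonlinear term of \<open>t_eq\<close> leaves linear
    constraints on \<open>t\<close>.\<close>
  moreover have "0 < t * e3" "t * e3 < 1 / 2 * e3"
    using mult_pos_pos[OF t(1) dec(1)] mult_strict_right_mono[OF t(2) dec(1)] by blast+
  ultimately have e: "t < e1" "e2 < t" "t < e2 + e3 / 2"
    using t t_eq by linarith+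
  note e = e t dec gap sum
  define f where "f = (\<lambda>zs. ends_at_zero \<beta> (neg_reduce \<beta> (window_val \<beta> m 1 zs)))"
  define v where "v = (\<lambda>a b.
    - (e1 + e2) * of_int a + e1 * of_int b)"
  have val: "window_val \<beta> m (Suc 0) [a, b] = v a b" for a b
    using h by (simp add: v_def algebra_simps del: horner.simps)
  have step: "f [a, b]" if "f [z, a]"
    "t - 1 \<le> of_int z + v a b" "of_int z + v a b < t" for z a b
    unfolding f_def
  proof (rule ends_at_zero_window_step[OF assms(1), where z = z])
    show "horner \<beta> m (Suc (length [a, b])) = 0" using h0 by (simp del: horner.simps)
    show "of_int z + window_val \<beta> m 1 [a, b] \<in> neg_dom \<beta>"
      using that(2,3) assms(1) unfolding One_nat_def val by (simp add: neg_dom_iff t_def)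
    show "ends_at_zero \<beta> (neg_reduce \<beta> (window_val \<beta> m 1 (butlast [z, a, b])))"
      using that(1) by (simp add: f_def del: window_val.simps)
  qed
  note step = step[unfolded v_def]
  have f0: "f [0, 0]"
    using assms(1) by (simp add: f_def neg_reduce_id zero_in_neg_dom ends_at_zero_zero)
  \<comment> \<open>The six nonzero windows form a single chain leading to the zero window, listed
    backwards.\<close>
  have f1: "f [0, - 1]" by (rule step[OF f0]; simp; use e in linarith)
  have f2: "f [- 1, - 1]" by (rule step[OF f1]; simp; use e in linarith)
  have f3: "f [- 1, 0]" by (rule step[OF f2]; simp; use e in linarith)
  have f4: "f [0, 1]" by (rule step[OF f3]; simp; use e in linarith)
  have f5: "f [1, 1]" by (rule step[OF f4]; simp; use e in linarith)
  have f6: "f [1, 0]" by (rule step[OF f5]; simp; use e in linarith)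
  define P :: "int list set" where "P = {
    [- 1, - 1], [- 1, 0], [0, 1]}"
  define N :: "int list set" where "N = {
    [0, - 1], [1, 0], [1, 1]}"
  define W where "W = insert [0, 0] (P \<union> N)"
  note WPN = W_def P_def N_def
  define C where "C = (\<lambda>zs. \<forall>z.
    \<bar>of_int z + window_val \<beta> m 1 zs\<bar> < 1 \<longrightarrow> butlast (z # zs) \<in> W)"
  have C_zero: "C [0, 0]"
    using int_near_cases(3) by (auto simp: C_def v_def WPN val simp del: window_val.simps)
  \<comment> \<open>For a value strictly between 0 and 1 only \<open>z = - 1\<close> and
    \<open>z = 0\<close> are admissible, so closure reduces to two memberships; \<open>C_neg\<close>
    is the mirror image.\<close>
  have C_pos: "C [a, b]" if "0 < v a b" "v a b < 1"
    "[- 1, a] \<in> W" "[0, a] \<in> W" for a b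
    using that(3,4) int_near_cases(1)[OF _ that(1,2)]
    by (auto simp: C_def val simp del: window_val.simps)
  have C_neg: "C [a, b]" if "- 1 < v a b" "v a b < 0"
    "[0, a] \<in> W" "[1, a] \<in> W" for a b
    using that(3,4) int_near_cases(2)[OF _ that(1,2)]
    by (auto simp: C_def val simp del: window_val.simps)
  have "\<forall>zs\<in>P. C zs"
    unfolding P_def ball_simps
    by (intro conjI TrueI; rule C_pos; simp add: v_def WPN; use e in linarith)
  moreover have "\<forall>zs\<in>N. C zs"
    unfolding N_def ball_simps
    by (intro conjI TrueI; rule C_neg; simp add: v_def WPN; use e in linarith)
  ultimately have closed: "\<forall>zs\<in>W. C zs"
    using C_zero by (simp add: W_def ball_Un)
  have fin: "\<forall>zs\<in>W. f zs"
    by (simp add: WPN f0 f1 f2 f3 f4 f5 f6)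
  show ?thesis
  proof (rule property_neg_F_witness[OF assms(1), of m 2 W])
    show "horner \<beta> m (Suc 2) = 0" using assms(3) by simp
    show "length zs = 2" if "zs \<in> W" for zs using that by (auto simp: WPN)
    show "ends_at_zero \<beta> (neg_reduce \<beta> (window_val \<beta> m 1 zs))" if "zs \<in> W" for zs
      using bspec[OF fin that] by (simp only: f_def)
    show "(replicate 2 0)[j := c] \<in> W" if "j < 2" "c \<in> {1, - 1}" for j c
      using that by (auto simp: WPN less_Suc_eq numeral_eq_Suc)
    show "butlast (z # zs) \<in> W"
      if "zs \<in> W" "\<bar>of_int z + window_val \<beta> m 1 zs\<bar> < 1" for z zs
      using bspec[OF closed that(1)] that(2) unfolding C_def by blast
  qed
qed

lemma property_neg_F_5:
  assumes "\<beta> > 1" "m > 0" "horner \<beta> m 5 = 0"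
  shows "property_neg_F \<beta>"
proof -
  define q where "q = inverse \<beta>"
  have q: "\<beta> * q = 1" "0 < q" "q < 1" using assms(1) by (simp_all add: q_def field_simps)
  have h0: "horner \<beta> m (Suc (Suc (Suc (Suc (Suc 0))))) = 0"
    using assms(3) by (simp add: numeral_eq_Suc del: horner.simps)
  define e1 e2 e3 e4 e5 where
    "e1 = m * q" and "e2 = e1 * q" and "e3 = e2 * q" and "e4 = e3 * q" and "e5 = e4 * q"
  have h: "horner \<beta> m (Suc 0) = e1 + e2 + e3 + e4"
    "horner \<beta> m (Suc (Suc 0)) = e1 + e2 + e3"
    "horner \<beta> m (Suc (Suc (Suc 0))) = e1 + e2"
    "horner \<beta> m (Suc (Suc (Suc (Suc 0)))) = e1"
    and sum: "e1 + e2 + e3 + e4 + e5 = 1"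
    using h0 q(1) unfolding e1_def e2_def e3_def e4_def e5_def horner.simps by algebra+
  define t where "t = 1 / (\<beta> + 1)"
  have t: "0 < t" "t < 1 / 2" "t < q" using assms(1) by (simp_all add: t_def q_def field_simps)
  have "t * (\<beta> + 1) = 1" using assms(1) by (simp add: t_def)
  then have t_eq: "t = e2 + e4 + t * e5"
    using sum q(1) unfolding e1_def e2_def e3_def e4_def e5_def by algebra
  have dec: "0 < e5" "e5 < e4" "e4 < e3" "e3 < e2" "e2 < e1"
    using q assms(2) by (simp_all add: e1_def e2_def e3_def e4_def e5_def)
  have "1 \<le> real m" using assms(2) by simp
  from mult_right_mono[OF this, of q] have "q \<le> e1" using q(2) by (simp add: e1_def)
  moreover have "q * q \<le> e2" using \<open>q \<le> e1\<close> q by (simp add: e2_def)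
  ultimately have "q + q * q < 1" using sum dec by linarith
  then have "e * q + e * q * q < e" if "0 < e" for e
    using mult_strict_left_mono[OF _ that, of "q + q * q" 1] by (simp add: algebra_simps)
  from this[of e1] this[of e2] this[of e3] have gap: "e2 + e3 < e1" "e3 + e4 < e2" "e4 + e5 < e3"
    using dec by (simp_all only: e2_def e3_def e4_def e5_def)
  note \<open>q \<le> e1\<close>
  moreover have "0 < t * e5" "t * e5 < 1 / 2 * e5"
    using mult_pos_pos[OF t(1) dec(1)] mult_strict_right_mono[OF t(2) dec(1)] by blast+
  ultimately have e: "t < e1" "e2 + e4 < t" "t < e2 + e4 + e5 / 2"
    using t t_eq by linarith+
  note e = e t dec gap sum
  define f where "f = (\<lambda>zs. ends_at_zero \<beta> (neg_reduce \<beta> (window_val \<beta> m 1 zs)))"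
  define v where "v = (\<lambda>a b c d.
    - (e1 + e2 + e3 + e4) * of_int a + (e1 + e2 + e3) * of_int b
    - (e1 + e2) * of_int c + e1 * of_int d)"
  have val: "window_val \<beta> m (Suc 0) [a, b, c, d] = v a b c d" for a b c d
    using h by (simp add: v_def algebra_simps del: horner.simps)
  have step: "f [a, b, c, d]" if "f [z, a, b, c]"
    "t - 1 \<le> of_int z + v a b c d" "of_int z + v a b c d < t" for z a b c d
    unfolding f_def
  proof (rule ends_at_zero_window_step[OF assms(1), where z = z])
    show "horner \<beta> m (Suc (length [a, b, c, d])) = 0" using h0 by (simp del: horner.simps)
    show "of_int z + window_val \<beta> m 1 [a, b, c, d] \<in> neg_dom \<beta>"
      using that(2,3) assms(1) unfolding One_nat_def val by (simp add: neg_dom_iff t_def)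
    show "ends_at_zero \<beta> (neg_reduce \<beta> (window_val \<beta> m 1 (butlast [z, a, b, c, d])))"
      using that(1) by (simp add: f_def del: window_val.simps)
  qed
  note step = step[unfolded v_def]
  have f0: "f [0, 0, 0, 0]"
    using assms(1) by (simp add: f_def neg_reduce_id zero_in_neg_dom ends_at_zero_zero)
  \<comment> \<open>Here the backward orbits form a tree rooted at the zero window, branching at
    \<open>f2\<close>, \<open>f4\<close>, \<open>f8\<close> and \<open>f18\<close>.\<close>
  have f1: "f [0, 0, 0, - 1]" by (rule step[OF f0]; simp; use e in linarith)
  have f2: "f [0, 0, - 1, - 1]" by (rule step[OF f1]; simp; use e in linarith)
  have f3: "f [0, - 1, - 1, 0]" by (rule step[OF f2]; simp; use e in linarith)
  have f4: "f [- 1, - 1, 0, 0]" by (rule step[OF f3]; simp; use e in linarith)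
  have f5: "f [- 1, 0, 0, - 1]" by (rule step[OF f4]; simp; use e in linarith)
  have f6: "f [0, 0, - 1, 0]" by (rule step[OF f5]; simp; use e in linarith)
  have f7: "f [0, - 1, 0, 1]" by (rule step[OF f6]; simp; use e in linarith)
  have f8: "f [- 1, 0, 1, 0]" by (rule step[OF f7]; simp; use e in linarith)
  have f9: "f [0, 1, 0, - 1]" by (rule step[OF f8]; simp; use e in linarith)
  have f10: "f [1, 0, - 1, 0]" by (rule step[OF f9]; simp; use e in linarith)
  have f11: "f [0, - 1, 0, 0]" by (rule step[OF f10]; simp; use e in linarith)
  have f12: "f [0, 1, 0, 0]" by (rule step[OF f8]; simp; use e in linarith)
  have f13: "f [1, 0, 0, 1]" by (rule step[OF f12]; simp; use e in linarith)
  have f14: "f [0, 0, 1, 0]" by (rule step[OF f13]; simp; use e in linarith)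
  have f15: "f [- 1, 0, 0, 0]" by (rule step[OF f4]; simp; use e in linarith)
  have f16: "f [0, 0, 0, 1]" by (rule step[OF f15]; simp; use e in linarith)
  have f17: "f [0, 0, 1, 1]" by (rule step[OF f16]; simp; use e in linarith)
  have f18: "f [0, 1, 1, 0]" by (rule step[OF f17]; simp; use e in linarith)
  have f19: "f [1, 1, 0, - 1]" by (rule step[OF f18]; simp; use e in linarith)
  have f20: "f [1, 0, - 1, - 1]" by (rule step[OF f19]; simp; use e in linarith)
  have f21: "f [1, 1, 0, 0]" by (rule step[OF f18]; simp; use e in linarith)
  have f22: "f [1, 0, 0, 0]" by (rule step[OF f21]; simp; use e in linarith)
  have f23: "f [0, - 1, - 1, - 1]" by (rule step[OF f2]; simp; use e in linarith)
  have f24: "f [- 1, - 1, - 1, - 1]" by (rule step[OF f23]; simp; use e in linarith)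
  have f25: "f [- 1, - 1, - 1, 0]" by (rule step[OF f24]; simp; use e in linarith)
  have f26: "f [- 1, - 1, 0, 1]" by (rule step[OF f25]; simp; use e in linarith)
  have f27: "f [- 1, 0, 1, 1]" by (rule step[OF f26]; simp; use e in linarith)
  have f28: "f [0, 1, 1, 1]" by (rule step[OF f27]; simp; use e in linarith)
  have f29: "f [1, 1, 1, 1]" by (rule step[OF f28]; simp; use e in linarith)
  have f30: "f [1, 1, 1, 0]" by (rule step[OF f29]; simp; use e in linarith)
  define P :: "int list set" where "P = {
    [- 1, - 1, - 1, - 1], [- 1, - 1, - 1, 0], [- 1, - 1, 0, 0], [- 1, - 1, 0, 1],
    [- 1, 0, 0, - 1], [- 1, 0, 0, 0], [- 1, 0, 1, 0], [- 1, 0, 1, 1],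
    [0, 0, - 1, - 1], [0, 0, - 1, 0], [0, 0, 0, 1], [0, 1, 0, - 1],
    [0, 1, 0, 0], [0, 1, 1, 0], [0, 1, 1, 1]}"
  define N :: "int list set" where "N = {
    [0, - 1, - 1, - 1], [0, - 1, - 1, 0], [0, - 1, 0, 0], [0, - 1, 0, 1],
    [0, 0, 0, - 1], [0, 0, 1, 0], [0, 0, 1, 1], [1, 0, - 1, - 1],
    [1, 0, - 1, 0], [1, 0, 0, 0], [1, 0, 0, 1], [1, 1, 0, - 1],
    [1, 1, 0, 0], [1, 1, 1, 0], [1, 1, 1, 1]}"
  define W where "W = insert [0, 0, 0, 0] (P \<union> N)"
  note WPN = W_def P_def N_def
  define C where "C = (\<lambda>zs. \<forall>z.
    \<bar>of_int z + window_val \<beta> m 1 zs\<bar> < 1 \<longrightarrow> butlast (z # zs) \<in> W)"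
  have C_zero: "C [0, 0, 0, 0]"
    using int_near_cases(3) by (auto simp: C_def v_def WPN val simp del: window_val.simps)
  have C_pos: "C [a, b, c, d]" if "0 < v a b c d" "v a b c d < 1"
    "[- 1, a, b, c] \<in> W" "[0, a, b, c] \<in> W" for a b c d
    using that(3,4) int_near_cases(1)[OF _ that(1,2)]
    by (auto simp: C_def val simp del: window_val.simps)
  have C_neg: "C [a, b, c, d]" if "- 1 < v a b c d" "v a b c d < 0"
    "[0, a, b, c] \<in> W" "[1, a, b, c] \<in> W" for a b c d
    using that(3,4) int_near_cases(2)[OF _ that(1,2)]
    by (auto simp: C_def val simp del: window_val.simps)
  have "\<forall>zs\<in>P. C zs"
    unfolding P_def ball_simps
    by (intro conjI TrueI; rule C_pos; simp add: v_def WPN; use e in linarith)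
  moreover have "\<forall>zs\<in>N. C zs"
    unfolding N_def ball_simps
    by (intro conjI TrueI; rule C_neg; simp add: v_def WPN; use e in linarith)
  ultimately have closed: "\<forall>zs\<in>W. C zs"
    using C_zero by (simp add: W_def ball_Un)
  have fin: "\<forall>zs\<in>W. f zs"
    by (simp add: WPN f0 f1 f2 f3 f4 f5 f6 f7 f8 f9 f10 f11 f12 f13 f14 f15
      f16 f17 f18 f19 f20 f21 f22 f23 f24 f25 f26 f27 f28 f29 f30)
  show ?thesis
  proof (rule property_neg_F_witness[OF assms(1), of m 4 W])
    show "horner \<beta> m (Suc 4) = 0" using assms(3) by simp
    show "length zs = 4" if "zs \<in> W" for zs using that by (auto simp: WPN)
    show "ends_at_zero \<beta> (neg_reduce \<beta> (window_val \<beta> m 1 zs))" if "zs \<in> W" for zs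
      using bspec[OF fin that] by (simp only: f_def)
    show "(replicate 4 0)[j := c] \<in> W" if "j < 4" "c \<in> {1, - 1}" for j c
      using that by (auto simp: WPN less_Suc_eq numeral_eq_Suc)
    show "butlast (z # zs) \<in> W"
      if "zs \<in> W" "\<bar>of_int z + window_val \<beta> m 1 zs\<bar> < 1" for z zs
      using bspec[OF closed that(1)] that(2) unfolding C_def by blast
  qed
qed

text \<open>Here \<open>\<beta> = m\<close>, so \<open>int_adjoin \<beta>\<close> consists of the
  integers and the empty window suffices.\<close>

lemma property_neg_F_1:
  assumes "\<beta> > 1" "horner \<beta> m 1 = 0"
  shows "property_neg_F \<beta>"
proof (rule property_neg_F_witness[OF assms(1), of m 0 "{[]}"])
  show "ends_at_zero \<beta> (neg_reduce \<beta> (window_val \<beta> m 1 zs))" if "zs \<in> {[]}" for zs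
    using that assms(1) by (simp add: neg_reduce_id zero_in_neg_dom ends_at_zero_zero)
qed (use assms(2) in auto)

theorem theorem3:
  fixes \<beta> :: real and d m :: nat
  assumes "\<beta> > 1" and "d > 0" and "m > 0"
    and "poly (monom 1 d - smult (of_nat m) (\<Sum>i<d. monom 1 i)) \<beta> = 0"
  shows "property_neg_F \<beta> \<longleftrightarrow> d \<in> {1, 3, 5}"
proof -
  have root: "\<beta> ^ d = real m * (\<Sum>i<d. \<beta> ^ i)"
    using assms(4) by (simp add: poly_monom poly_sum)
  then have h: "horner \<beta> m d = 0" by (simp add: horner_eq)
  consider "even d" | "odd d" "d \<ge> 7" | "d = 1" | "d = 3" | "d = 5"
  proof -
    have "d \<ge> 7 \<or> d \<in> {1, 2, 3, 4, 5, 6}" using assms(2) by auto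
    then show thesis using that by auto
  qed
  then show ?thesis
  proof cases
    case 1
    then show ?thesis using not_property_neg_F_even[OF assms(1) 1 root] by auto
  next
    case 2
    then show ?thesis using not_property_neg_F_odd[OF assms(1,3) 2 root] by auto
  next
    case 3
    then show ?thesis using property_neg_F_1[OF assms(1)] h by auto
  next
    case 4
    then show ?thesis using property_neg_F_3[OF assms(1,3)] h by auto
  next
    case 5
    then show ?thesis using property_neg_F_5[OF assms(1,3)] h by auto
  qed
qed

end
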